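(* Let $0\le M<N$ be integers, $a=(a_1,\dots,a_M)$ and $b=(b_0,b_1,\dots,b_N)$ with all entries positive. Writing $\Omega=\sum_{i=1}^Mn_ia_i$, $$\mathbf{P}\bigl[\beta_{M,N}(a,b)=1\bigr]=\prod_{n_1,\dots,n_M=0}^\infty\Bigl[\frac{b_0+\Omega}{\prod_{j_1=1}^N(b_0+b_{j_1}+\Omega)}\cdot\frac{\prod_{j_1<j_2}^N(b_0+b_{j_1}+b_{j_2}+\Omega)}{\prod_{j_1<j_2<j_3}^N(b_0+b_{j_1}+b_{j_2}+b_{j_3}+\Omega)}\cdots\Bigr],$$ where the bracket is $\prod_{J\subseteq\{1,\dots,N\}}\bigl(b_0+\sum_{j\in J}b_j+\Omega\bigr)^{(-1)^{|J|}}$.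
   Context: Barnes multiple log-gamma function: for $a=(a_1,\dots,a_M)$, $a_j>0$, $\zeta_M(s,w\,|\,a)=\sum_{k_1,\dots,k_M=0}^\infty(w+k_1a_1+\cdots+k_Ma_M)^{-s}$ for $\Re(s)>M$, $\Re(w)>0$, continued meromorphically in $s$; $L_M(w\,|\,a)=\partial_s\zeta_M(s,w\,|\,a)|_{s=0}$, continued analytically to $w\in\mathbb{C}\setminus(-\infty,0]$; $L_0(w)=-\log w$. Operator $\mathcal{S}_N$: $(\mathcal{S}_Nh)(q\,|\,b)=\sum_{J\subseteq\{1,\dots,N\}}(-1)^{|J|}h\bigl(q+b_0+\sum_{j\in J}b_j\bigr)$. Barnes beta distribution: for $M\le N$ the function $\eta_{M,N}(q\,|\,a,b)=\exp\bigl((\mathcal{S}_NL_M)(q\,|\,a,b)-(\mathcal{S}_NL_M)(0\,|\,a,b)\bigr)$ (with $h=L_M(\cdot\,|\,a)$) is known to be the Mellin transform of a unique probability distribution on $(0,1]$; a random variable with this law is denoted $\beta_{M,N}(a,b)$, i.e. $\mathbf{E}[\beta_{M,N}(a,b)^q]=\eta_{M,N}(q\,|\,a,b)$ for $\Re(q)>-b_0$. *)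

theory Defs
  imports "HOL-Complex_Analysis.Complex_Analysis" "HOL-Probability.Probability"
begin

text \<open>
  The tuple \<open>a\<close> is a function whose values at \<open>1, \<dots>, M\<close> are used, and the tuple \<open>b\<close> is a
  function whose values at \<open>0, \<dots>, N\<close> are used. A multi-index in \<open>\<nat>\<close> to the power \<open>M\<close> is an
  extensional function on \<open>{1..M}\<close>; for \<open>M = 0\<close> there is exactly one.
\<close>

definition multi_indices :: "nat \<Rightarrow> (nat \<Rightarrow> nat) set" where
  "multi_indices M = ({1..M} \<rightarrow>\<^sub>E UNIV)"

definition lattice_sum :: "nat \<Rightarrow> (nat \<Rightarrow> real) \<Rightarrow> (nat \<Rightarrow> nat) \<Rightarrow> real" where
  "lattice_sum M a n = (\<Sum>i=1..M. real (n i) * a i)"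

text \<open>
  The meromorphic continuation in \<open>s\<close>. The normalisation built into \<open>nicely_meromorphic_on\<close>
  (value 0 at poles, removable singularities removed) makes the continuation unique as a total
  function, so that its value and derivative at a regular point such as \<open>s = 0\<close> are determined.
\<close>

definition barnes_zeta :: "nat \<Rightarrow> (nat \<Rightarrow> real) \<Rightarrow> complex \<Rightarrow> complex \<Rightarrow> complex" where
  "barnes_zeta M a w = (THE f. f nicely_meromorphic_on UNIV \<and>
     (\<forall>s. Re s > real M \<longrightarrow>
        f s = (\<Sum>\<^sub>\<infinity>k\<in>multi_indices M. (w + of_real (lattice_sum M a k)) powr (- s))))"

text \<open>
  With principal powers, the series above still converges for \<open>Re s > M\<close> and is holomorphic in
  \<open>w\<close> on the plane slit along the nonpositive real axis, so no separate continuation in \<open>w\<close>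
  is taken; only arguments with positive real part occur below in any case.
\<close>

definition barnes_L :: "nat \<Rightarrow> (nat \<Rightarrow> real) \<Rightarrow> complex \<Rightarrow> complex" where
  "barnes_L M a w = (if M = 0 then - Ln w else deriv (barnes_zeta M a w) 0)"

definition barnes_S :: "nat \<Rightarrow> (nat \<Rightarrow> real) \<Rightarrow> (complex \<Rightarrow> complex) \<Rightarrow> complex \<Rightarrow> complex" where
  "barnes_S N b h q =
     (\<Sum>J\<in>Pow {1..N}. (-1) ^ card J * h (q + of_real (b 0) + of_real (\<Sum>j\<in>J. b j)))"

definition barnes_eta ::
  "nat \<Rightarrow> nat \<Rightarrow> (nat \<Rightarrow> real) \<Rightarrow> (nat \<Rightarrow> real) \<Rightarrow> complex \<Rightarrow> complex" where
  "barnes_eta M N a b q =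
     exp (barnes_S N b (barnes_L M a) q - barnes_S N b (barnes_L M a) 0)"

text \<open>The probability law on \<open>(0, 1]\<close>, seen as a Borel measure on the reals, whose Mellin
  transform is \<open>barnes_eta\<close>.\<close>

definition barnes_beta_law ::
  "nat \<Rightarrow> nat \<Rightarrow> (nat \<Rightarrow> real) \<Rightarrow> (nat \<Rightarrow> real) \<Rightarrow> real measure \<Rightarrow> bool" where
  "barnes_beta_law M N a b \<mu> \<longleftrightarrow>
     prob_space \<mu> \<and> sets \<mu> = sets borel \<and> (AE x in \<mu>. x \<in> {0<..1}) \<and>
     (\<forall>q. Re q > - b 0 \<longrightarrow>
        has_bochner_integral \<mu> (\<lambda>x. complex_of_real x powr q) (barnes_eta M N a b q))"

text \<open>
  Unordered infinite product of nonzero factors over an arbitrary index set: the net of finite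
  partial products converges, and, as is customary for infinite products, to a nonzero limit.
\<close>

definition has_unordered_prod :: "('i \<Rightarrow> real) \<Rightarrow> 'i set \<Rightarrow> real \<Rightarrow> bool" where
  "has_unordered_prod f A p \<longleftrightarrow>
     ((\<lambda>F. \<Prod>i\<in>F. f i) \<longlongrightarrow> p) (finite_subsets_at_top A) \<and> p \<noteq> 0"

end

theory Submission
  imports Defs
begin

text \<open>
  Since \<open>\<beta>\<close> lies in \<open>(0, 1]\<close>, the probability of \<open>\<beta> = 1\<close> is the limit of the moments
  \<open>E \<beta>^q = exp (S_N L_M (q) - S_N L_M (0))\<close> as \<open>q \<rightarrow> \<infinity>\<close>. Applied to the series defining the zeta
  function, the \<open>N\<close>-fold difference operator \<open>S_N\<close> improves the decay of the terms from
  \<open>x powr (-s)\<close> to \<open>x powr (-s - N)\<close>, so the differenced series converges for \<open>Re s > M - N\<close>, a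
  half-plane containing 0, and can be differentiated there term by term: \<open>S_N L_M (q)\<close> is minus the
  sum of the \<open>N\<close>-fold differences of \<open>ln\<close> at the points \<open>q + b_0 + \<Omega>\<close>. This tends to 0
  as \<open>q \<rightarrow> \<infinity>\<close>, and exponentiating the sum at \<open>q = 0\<close> gives the product.

  That the zeta function continues meromorphically to the plane and is regular at 0 follows from
  \<open>\<zeta>_M (s, w) - \<zeta>_M (s, w + a_M) = \<zeta>_(M-1) (s, w)\<close>: expanding the second term in powers of \<open>a_M\<close>
  turns this into a recurrence that extends \<open>(s - 1) \<cdots> (s - M) \<zeta>_M (s, w)\<close> to the left, one unit
  strip after another, without poles. Only real \<open>w > 0\<close> are needed.
\<close>

section \<open>Series over the lattice\<close>

lemma lattice_sum_nonneg:
  assumes "\<And>i. i \<in> {1..M} \<Longrightarrow> a i > 0"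
  shows "lattice_sum M a n \<ge> 0"
  unfolding lattice_sum_def using assms by (intro sum_nonneg mult_nonneg_nonneg) (auto simp: less_imp_le)

text \<open>For \<open>M > 0\<close> let \<open>c\<close> be the least of \<open>w\<close> and the
  \<open>a i\<close>, so that each \<open>c * (1 + n i)\<close> is at most
  \<open>w + lattice_sum M a n\<close>. Splitting the power into \<open>M\<close> equal powers of
  exponent \<open>-p\<close>, where \<open>p = \<sigma> / M > 1\<close>, gives a majorant that is a
  product of convergent one-dimensional series.\<close>

lemma summable_on_lattice_powr:
  fixes w \<sigma> :: real
  assumes a: "\<And>i. i \<in> {1..M} \<Longrightarrow> a i > 0" and w: "w > 0" and \<sigma>: "\<sigma> > real M"
  shows "(\<lambda>n. (w + lattice_sum M a n) powr (-\<sigma>)) summable_on multi_indices M"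
proof (cases "M = 0")
  case True
  then show ?thesis by (simp add: multi_indices_def)
next
  case False
  define c where "c = Min (insert w (a ` {1..M}))"
  have c: "c > 0" "c \<le> w" "\<And>i. i \<in> {1..M} \<Longrightarrow> c \<le> a i"
    unfolding c_def using a w by (auto intro: Min_le simp del: Min_insert)
  define p where "p = \<sigma> / real M"
  have p: "p > 1" using \<sigma> False by (simp add: p_def field_simps)
  define g :: "nat \<Rightarrow> nat \<Rightarrow> real" where "g = (\<lambda>i k. (c * (1 + real k)) powr (-p))"
  have "summable (\<lambda>k. real (Suc k) powr (-p))"
    using p by (subst summable_Suc_iff) (simp add: summable_real_powr_iff)
  then have "summable (\<lambda>k. c powr (-p) * real (Suc k) powr (-p))" by (rule summable_mult)
  moreover have "norm (g i k) = c powr (-p) * real (Suc k) powr (-p)" for i k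
    using c(1) by (simp add: g_def powr_mult add.commute)
  ultimately have "summable (\<lambda>k. norm (g i k))" for i by simp
  \<comment> \<open>The product rule over \<open>PiE\<close> index sets applied next is stated for
    this notion of summability; \<open>abs_summable_equivalent\<close> leads back.\<close>
  then have "Infinite_Set_Sum.abs_summable_on (g i) UNIV" for i
    by (simp add: abs_summable_on_nat_iff')
  then have "Infinite_Set_Sum.abs_summable_on (\<lambda>n. \<Prod>i\<in>{1..M}. g i (n i)) (multi_indices M)"
    unfolding multi_indices_def by (intro abs_summable_on_prod_PiE) auto
  then have S: "(\<lambda>n. norm (\<Prod>i\<in>{1..M}. g i (n i))) summable_on multi_indices M"
    by (simp only: abs_summable_equivalent)
  show ?thesis
  proof (rule summable_on_comparison_test[OF S])
    fix n
    have nn: "0 \<le> lattice_sum M a n" using lattice_sum_nonneg[of M a n] a by auto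
    have le: "c * (1 + real (n i)) \<le> w + lattice_sum M a n" if i: "i \<in> {1..M}" for i
    proof -
      have "c * real (n i) \<le> real (n i) * a i"
        using mult_right_mono[OF c(3)[OF i], of "real (n i)"] by (simp add: mult.commute)
      also have "\<dots> \<le> lattice_sum M a n"
        unfolding lattice_sum_def using i a
        by (intro member_le_sum[of i "{1..M}" "\<lambda>i. real (n i) * a i"]) (auto simp: less_imp_le)
      finally show ?thesis using c(2) by (simp add: algebra_simps)
    qed
    have "(w + lattice_sum M a n) powr (-\<sigma>) = (\<Prod>i\<in>{1..M}. (w + lattice_sum M a n) powr (-p))"
      using w nn False by (simp add: p_def powr_power)
    also have "\<dots> \<le> (\<Prod>i\<in>{1..M}. g i (n i))"
    proof (intro prod_mono conjI)
      fix i assume "i \<in> {1..M}"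
      have "0 < c * (1 + real (n i))" using c(1) by (intro mult_pos_pos) auto
      then show "(w + lattice_sum M a n) powr (-p) \<le> g i (n i)"
        unfolding g_def using le[OF \<open>i \<in> {1..M}\<close>] p by (intro powr_mono2') auto
    qed simp
    also have "\<dots> \<le> norm (\<Prod>i\<in>{1..M}. g i (n i))" by simp
    finally show "(w + lattice_sum M a n) powr (-\<sigma>) \<le> norm (\<Prod>i\<in>{1..M}. g i (n i))" .
  qed auto
qed

text \<open>Local summable majorants make the finite partial sums converge uniformly on closed
  discs. Such limits are holomorphic, and the derivatives converge to the derivative of the
  limit.\<close>

lemma infsum_holomorphic:
  fixes f :: "'i \<Rightarrow> complex \<Rightarrow> complex"
  assumes U: "open U" and hol: "\<And>i. i \<in> A \<Longrightarrow> f i holomorphic_on U"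
    and bd: "\<And>z. z \<in> U \<Longrightarrow>
      \<exists>r>0. \<exists>g. g summable_on A \<and> (\<forall>i\<in>A. \<forall>s\<in>cball z r \<inter> U. norm (f i s) \<le> g i)"
  shows "(\<lambda>s. \<Sum>\<^sub>\<infinity>i\<in>A. f i s) holomorphic_on U"
    and "z \<in> U \<Longrightarrow> ((\<lambda>i. deriv (f i) z) has_sum deriv (\<lambda>s. \<Sum>\<^sub>\<infinity>i\<in>A. f i s) z) A"
proof -
  have *: "(\<lambda>s. \<Sum>\<^sub>\<infinity>i\<in>A. f i s) field_differentiable at z \<and>
      ((\<lambda>i. deriv (f i) z) has_sum deriv (\<lambda>s. \<Sum>\<^sub>\<infinity>i\<in>A. f i s) z) A" if z: "z \<in> U" for z
  proof -
    obtain r g where rg: "r > 0" "g summable_on A"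
        "\<And>i s. i \<in> A \<Longrightarrow> s \<in> cball z r \<inter> U \<Longrightarrow> norm (f i s) \<le> g i"
      using bd[OF z] by blast
    obtain r' where r': "r' > 0" "cball z r' \<subseteq> U" using U z open_contains_cball by blast
    define d where "d = min r r'"
    have d: "d > 0" "cball z d \<subseteq> U" "cball z d \<subseteq> cball z r" using rg r' by (auto simp: d_def)
    have ul: "uniform_limit (cball z d) (\<lambda>X s. \<Sum>i\<in>X. f i s) (\<lambda>s. \<Sum>\<^sub>\<infinity>i\<in>A. f i s)
        (finite_subsets_at_top A)"
      using d rg(3) by (intro Weierstrass_m_test_general[where M = g] rg(2)) blast
    have ev: "eventually (\<lambda>X. continuous_on (cball z d) (\<lambda>s. \<Sum>i\<in>X. f i s) \<and>
        (\<forall>w\<in>ball z d. ((\<lambda>s. \<Sum>i\<in>X. f i s) has_field_derivative (\<Sum>i\<in>X. deriv (f i) w)) (at w)))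
        (finite_subsets_at_top A)"
    proof (rule eventually_finite_subsets_at_top_weakI, intro conjI ballI)
      fix X assume X: "finite X" "X \<subseteq> A"
      show "continuous_on (cball z d) (\<lambda>s. \<Sum>i\<in>X. f i s)"
        using X hol d holomorphic_on_imp_continuous_on
        by (intro continuous_on_sum) (blast intro: continuous_on_subset)
      fix w assume "w \<in> ball z d"
      then have "w \<in> U" using d by auto
      show "((\<lambda>s. \<Sum>i\<in>X. f i s) has_field_derivative (\<Sum>i\<in>X. deriv (f i) w)) (at w)"
        using X \<open>w \<in> U\<close> hol U by (intro DERIV_sum holomorphic_derivI) auto
    qed
    obtain g' where g': "\<And>w. w \<in> ball z d \<Longrightarrow>
        ((\<lambda>s. \<Sum>\<^sub>\<infinity>i\<in>A. f i s) has_field_derivative (g' w)) (at w) \<and>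
        ((\<lambda>X. \<Sum>i\<in>X. deriv (f i) w) \<longlongrightarrow> g' w) (finite_subsets_at_top A)"
      using has_complex_derivative_uniform_limit[OF ev ul _ d(1)] by auto
    have "z \<in> ball z d" using d by simp
    from g'[OF this] show ?thesis
      by (auto simp: has_sum_def field_differentiable_def DERIV_imp_deriv)
  qed
  show "(\<lambda>s. \<Sum>\<^sub>\<infinity>i\<in>A. f i s) holomorphic_on U"
    using * by (auto simp: holomorphic_on_def intro: field_differentiable_at_within)
  show "z \<in> U \<Longrightarrow> ((\<lambda>i. deriv (f i) z) has_sum deriv (\<lambda>s. \<Sum>\<^sub>\<infinity>i\<in>A. f i s) z) A"
    using * by blast
qed

lemma summable_on_lattice_bounded:
  fixes f :: "real \<Rightarrow> complex"
  assumes a: "\<And>i. i \<in> {1..M} \<Longrightarrow> a i > 0" and w: "w > 0" and \<sigma>: "\<sigma> > real M"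
    and bd: "\<And>x. x \<ge> w \<Longrightarrow> norm (f x) \<le> C * x powr (-\<sigma>)"
  shows "(\<lambda>n. f (w + lattice_sum M a n)) summable_on multi_indices M"
proof (rule abs_summable_summable, rule summable_on_comparison_test)
  show "(\<lambda>n. C * (w + lattice_sum M a n) powr (-\<sigma>)) summable_on multi_indices M"
    using a w \<sigma> by (intro summable_on_cmult_right summable_on_lattice_powr) auto
  show "norm (f (w + lattice_sum M a n)) \<le> C * (w + lattice_sum M a n) powr (-\<sigma>)" for n
    using bd lattice_sum_nonneg[of M a n] a by auto
qed auto

text \<open>\<open>K\<close> is the gain in decay: terms of size \<open>x powr (-(Re s + K))\<close>
  are summable over the lattice once \<open>Re s + K > M\<close>. Continuity of \<open>C\<close>
  bounds the remaining factor on discs.\<close>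

lemma infsum_lattice_holomorphic:
  fixes f :: "complex \<Rightarrow> real \<Rightarrow> complex" and K :: real and M :: nat
  defines "U \<equiv> {s. Re s > real M - K}"
  assumes a: "\<And>i. i \<in> {1..M} \<Longrightarrow> a i > 0" and w: "w > 0"
    and hol: "\<And>x. x \<ge> w \<Longrightarrow> (\<lambda>s. f s x) holomorphic_on U"
    and C: "continuous_on UNIV C"
    and bd: "\<And>s x. x \<ge> w \<Longrightarrow> s \<in> U \<Longrightarrow> norm (f s x) \<le> C s * x powr (-(Re s + K))"
  shows "(\<lambda>s. \<Sum>\<^sub>\<infinity>n\<in>multi_indices M. f s (w + lattice_sum M a n)) holomorphic_on U"
    and "z \<in> U \<Longrightarrow> ((\<lambda>n. deriv (\<lambda>s. f s (w + lattice_sum M a n)) z) has_sum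
           deriv (\<lambda>s. \<Sum>\<^sub>\<infinity>n\<in>multi_indices M. f s (w + lattice_sum M a n)) z) (multi_indices M)"
proof -
  have nn: "0 \<le> lattice_sum M a n" for n using lattice_sum_nonneg[of M a n] a by auto
  have U: "open U" unfolding U_def by (rule open_halfspace_Re_gt)
  have loc: "\<exists>r>0. \<exists>g. g summable_on multi_indices M \<and>
      (\<forall>n\<in>multi_indices M. \<forall>s\<in>cball z r \<inter> U. norm (f s (w + lattice_sum M a n)) \<le> g n)"
    if z: "z \<in> U" for z
  proof -
    \<comment> \<open>Half the distance from \<open>z\<close> to the line
      \<open>Re s = M - K\<close>: on the disc of radius \<open>r\<close> the exponent
      \<open>Re s + K\<close> stays at least \<open>\<sigma> > M\<close>.\<close>
    define r where "r = (Re z - (real M - K)) / 2"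
    have r: "r > 0" using z by (simp add: r_def U_def)
    define \<sigma> where "\<sigma> = Re z - r + K"
    have \<sigma>: "\<sigma> > real M" using r by (simp add: \<sigma>_def r_def field_simps)
    have "bdd_above (C ` cball z r)"
      by (intro bounded_imp_bdd_above compact_imp_bounded compact_continuous_image
          continuous_on_subset[OF C]) auto
    then obtain B where B: "\<And>s. s \<in> cball z r \<Longrightarrow> C s \<le> B"
      unfolding bdd_above_def by blast
    define B' where "B' = max B 0"
    \<comment> \<open>Bounds \<open>w powr (-\<delta>)\<close> for all \<open>\<delta>\<close>
      between 0 and \<open>2*r\<close>: by 1 if \<open>w \<ge> 1\<close>, otherwise by its value at
      \<open>2*r\<close>.\<close>
    define E where "E = max 1 (w powr (-(2*r)))"
    have pw: "x powr (-(Re s + K)) \<le> E * x powr (-\<sigma>)" if x: "x \<ge> w" and s: "s \<in> cball z r" for x s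
    proof -
      define \<delta> where "\<delta> = Re s - Re z + r"
      have "\<bar>Re s - Re z\<bar> \<le> r"
        using s abs_Re_le_cmod[of "s - z"] by (simp add: dist_norm norm_minus_commute)
      then have \<delta>: "0 \<le> \<delta>" "\<delta> \<le> 2*r" by (auto simp: \<delta>_def)
      have "x powr (-\<delta>) \<le> w powr (-\<delta>)" using x w \<delta> by (intro powr_mono2') auto
      also have "\<dots> \<le> E"
      proof (cases "w \<ge> 1")
        case True
        then have "w powr (-\<delta>) \<le> w powr 0" using \<delta> by (intro powr_mono) auto
        then show ?thesis using w by (simp add: E_def)
      next
        case False
        then have "w powr (-\<delta>) \<le> w powr (-(2*r))" using \<delta> w by (intro powr_mono') auto
        then show ?thesis by (simp add: E_def)
      qed
      finally have "x powr (-\<delta>) * x powr (-\<sigma>) \<le> E * x powr (-\<sigma>)" by (intro mult_right_mono) auto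
      moreover have "-\<delta> + -\<sigma> = -(Re s + K)" by (simp add: \<delta>_def \<sigma>_def)
      ultimately show ?thesis by (simp only: powr_add [symmetric])
    qed
    show ?thesis
    proof (intro exI[of _ r] conjI exI[of _ "\<lambda>n. B' * E * (w + lattice_sum M a n) powr (-\<sigma>)"] r ballI)
      show "(\<lambda>n. B' * E * (w + lattice_sum M a n) powr (-\<sigma>)) summable_on multi_indices M"
        using a w \<sigma> by (intro summable_on_cmult_right summable_on_lattice_powr) auto
      fix n s assume s: "s \<in> cball z r \<inter> U"
      define x where "x = w + lattice_sum M a n"
      have x: "x \<ge> w" using nn by (simp add: x_def)
      have "norm (f s x) \<le> C s * x powr (-(Re s + K))" using bd x s by auto
      also have "\<dots> \<le> B' * x powr (-(Re s + K))"
        using B[of s] s by (intro mult_right_mono) (auto simp: B'_def)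
      also have "\<dots> \<le> B' * (E * x powr (-\<sigma>))"
        using pw[OF x, of s] s by (intro mult_left_mono) (auto simp: B'_def)
      finally show "norm (f s (w + lattice_sum M a n)) \<le> B' * E * (w + lattice_sum M a n) powr (-\<sigma>)"
        by (simp add: x_def mult_ac)
    qed
  qed
  have hol': "(\<lambda>s. f s (w + lattice_sum M a n)) holomorphic_on U" for n using hol nn by simp
  show "(\<lambda>s. \<Sum>\<^sub>\<infinity>n\<in>multi_indices M. f s (w + lattice_sum M a n)) holomorphic_on U"
    by (rule infsum_holomorphic(1)[OF U hol' loc])
  show "z \<in> U \<Longrightarrow> ((\<lambda>n. deriv (\<lambda>s. f s (w + lattice_sum M a n)) z) has_sum
           deriv (\<lambda>s. \<Sum>\<^sub>\<infinity>n\<in>multi_indices M. f s (w + lattice_sum M a n)) z) (multi_indices M)"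
    by (rule infsum_holomorphic(2)[OF U hol' loc])
qed

section \<open>Taylor remainders and iterated differences\<close>

text \<open>The \<open>i\<close>-th derivative of \<open>\<lambda>z. z powr (- s)\<close>.\<close>

definition powr_derivs :: "complex \<Rightarrow> nat \<Rightarrow> complex \<Rightarrow> complex" where
  "powr_derivs s i z = (-1) ^ i * pochhammer s i * z powr (- s - of_nat i)"

lemma has_field_derivative_powr_derivs:
  assumes "z \<notin> \<real>\<^sub>\<le>\<^sub>0"
  shows "(powr_derivs s i has_field_derivative powr_derivs s (Suc i) z) (at z within S)"
  unfolding powr_derivs_def
  by (rule derivative_eq_intros refl assms)+
     (simp add: pochhammer_Suc algebra_simps)

lemma norm_powr_derivs:
  assumes "x > 0"
  shows "norm (powr_derivs s i (of_real x)) = norm (pochhammer s i) * x powr (- (Re s + real i))"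
  using assms by (simp add: powr_derivs_def norm_mult norm_power norm_powr_real_powr)

lemma norm_powr_derivs_le:
  assumes "x > 0" "y \<ge> x" "Re s + real i \<ge> 0"
  shows "norm (powr_derivs s i (of_real y)) \<le> norm (pochhammer s i) * x powr (- (Re s + real i))"
  using assms by (auto simp: norm_powr_derivs intro!: mult_left_mono powr_mono2')

text \<open>The Taylor expansion of \<open>(x + h) powr (1 - s)\<close> at \<open>x\<close>; the factor
  \<open>(-1) ^ i * pochhammer (s - 1) i / fact i\<close> is the binomial coefficient \<open>1 - s\<close> over \<open>i\<close>.\<close>

definition powr_remainder :: "nat \<Rightarrow> real \<Rightarrow> complex \<Rightarrow> real \<Rightarrow> complex" where
  "powr_remainder K h s x = of_real (x + h) powr (1 - s) -
     (\<Sum>i\<le>K. (-1) ^ i * pochhammer (s - 1) i * of_real x powr (1 - s - of_nat i) * of_real h ^ i / fact i)"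

text \<open>Taylor's theorem on the real ray from \<open>x\<close>, which is convex and avoids the
  branch cut. The derivative of order \<open>Suc K\<close> of \<open>z powr (1 - s)\<close> has real
  exponent \<open>-(Re s + K) \<le> 0\<close>, so on the ray its norm is largest at
  \<open>x\<close>.\<close>

lemma norm_powr_remainder_le:
  assumes "x > 0" "h > 0" "Re s + real K \<ge> 0"
  shows "norm (powr_remainder K h s x) \<le>
    norm (pochhammer (s - 1) (Suc K)) * h ^ Suc K / fact K * x powr (-(Re s + real K))"
proof -
  define S where "S = complex_of_real ` {x..}"
  have "norm (powr_derivs (s - 1) 0 (of_real (x + h)) -
     (\<Sum>i\<le>K. powr_derivs (s - 1) i (of_real x) * (of_real (x + h) - of_real x) ^ i / fact i))
     \<le> (norm (pochhammer (s - 1) (Suc K)) * x powr (- (Re (s - 1) + real (Suc K)))) *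
        norm (complex_of_real (x + h) - of_real x) ^ Suc K / fact K"
  proof (rule complex_Taylor)
    show "convex S" unfolding S_def by (intro convex_linear_image) (auto intro: bounded_linear.linear bounded_linear_of_real)
  next
    fix i z assume "z \<in> S"
    then show "(powr_derivs (s - 1) i has_field_derivative powr_derivs (s - 1) (Suc i) z) (at z within S)"
      using assms by (intro has_field_derivative_powr_derivs) (auto simp: S_def)
  next
    fix z assume "z \<in> S"
    then show "norm (powr_derivs (s - 1) (Suc K) z) \<le>
        norm (pochhammer (s - 1) (Suc K)) * x powr (- (Re (s - 1) + real (Suc K)))"
      using assms norm_powr_derivs_le[of x _ "s - 1" "Suc K"] by (auto simp: S_def)
  qed (use assms in \<open>auto simp: S_def simp flip: of_real_add\<close>)
  then show ?thesis
    using assms by (simp add: powr_derivs_def powr_remainder_def mult_ac)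
qed

lemma holomorphic_on_powr_remainder:
  assumes "x > 0" "h > 0"
  shows "(\<lambda>s. powr_remainder K h s x) holomorphic_on A"
proof -
  have "complex_of_real (x + h) \<noteq> 0" "complex_of_real x \<noteq> 0"
    using assms by (simp_all only: of_real_eq_0_iff)
  then show ?thesis
    unfolding powr_remainder_def by (intro holomorphic_intros) auto
qed

text \<open>The product over \<open>j\<close> of the operators "identity minus shift by
  \<open>b j\<close>", expanded over subsets. The shift by \<open>b 0\<close> in
  \<open>barnes_S\<close> is moved into the base point \<open>z\<close>.\<close>

definition iterated_diff :: "nat \<Rightarrow> (nat \<Rightarrow> real) \<Rightarrow> (complex \<Rightarrow> complex) \<Rightarrow> complex \<Rightarrow> complex" where
  "iterated_diff N b h z = (\<Sum>J\<in>Pow {1..N}. (-1) ^ card J * h (z + of_real (\<Sum>j\<in>J. b j)))"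

lemma iterated_diff_0 [simp]: "iterated_diff 0 b h z = h z"
  by (simp add: iterated_diff_def)

text \<open>The subsets containing \<open>Suc N\<close> arise from the others by adding it, which
  shifts the argument by \<open>b (Suc N)\<close> and flips the sign.\<close>

lemma iterated_diff_Suc:
  "iterated_diff (Suc N) b h z = iterated_diff N b (\<lambda>z. h z - h (z + of_real (b (Suc N)))) z"
proof -
  have P: "Pow {1..Suc N} = Pow {1..N} \<union> insert (Suc N) ` Pow {1..N}"
    by (simp add: atLeastAtMostSuc_conv Pow_insert)
  have inj: "inj_on (insert (Suc N)) (Pow {1..N})"
    by (rule inj_onI) (metis Diff_insert_absorb PowD Suc_n_not_le_n atLeastAtMost_iff subset_iff insert_Diff_single)
  have "(\<Sum>J\<in>insert (Suc N) ` Pow {1..N}. (-1) ^ card J * h (z + of_real (\<Sum>j\<in>J. b j))) =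
    (\<Sum>J\<in>Pow {1..N}. - ((-1) ^ card J * h (z + of_real (\<Sum>j\<in>J. b j) + of_real (b (Suc N)))))"
  proof (subst sum.reindex[OF inj], rule sum.cong)
    fix J assume J: "J \<in> Pow {1..N}"
    then have "finite J" "Suc N \<notin> J" by (auto intro: finite_subset)
    then show "((\<lambda>J. (-1) ^ card J * h (z + of_real (\<Sum>j\<in>J. b j))) \<circ> insert (Suc N)) J =
        - ((-1) ^ card J * h (z + of_real (\<Sum>j\<in>J. b j) + of_real (b (Suc N))))"
      by (simp add: add_ac)
  qed simp
  then show ?thesis
    unfolding iterated_diff_def P
    by (subst sum.union_disjoint) (auto simp: sum_negf sum_subtractf right_diff_distrib)
qed

text \<open>An \<open>N\<close>-fold mean value inequality, with \<open>f i\<close> as the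
  \<open>i\<close>-th derivative of \<open>f 0\<close>. Passing from \<open>f\<close> to its
  differences with step \<open>c = b (Suc N)\<close> uses up one derivative and multiplies the bound
  by \<open>c\<close>.\<close>

lemma norm_iterated_diff_le:
  fixes f :: "nat \<Rightarrow> complex \<Rightarrow> complex" and x :: real
  assumes b: "\<And>j. j \<in> {1..N} \<Longrightarrow> b j > 0"
    and f: "\<And>i y. i < N \<Longrightarrow> y \<ge> x \<Longrightarrow> (f i has_field_derivative f (Suc i) (of_real y)) (at (of_real y))"
    and B: "\<And>y. y \<ge> x \<Longrightarrow> norm (f N (of_real y)) \<le> B"
  shows "norm (iterated_diff N b (f 0) (of_real x)) \<le> B * (\<Prod>j\<in>{1..N}. b j)"
  using assms
proof (induction N arbitrary: f B)
  case 0
  then show ?case by simp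
next
  case (Suc N)
  define c where "c = b (Suc N)"
  have c: "c > 0" using Suc.prems(1) by (simp add: c_def)
  define g where "g = (\<lambda>i z. f i z - f i (z + of_real c))"
  have "norm (iterated_diff N b (g 0) (of_real x)) \<le> (B * c) * (\<Prod>j\<in>{1..N}. b j)"
  proof (rule Suc.IH)
    fix i y assume i: "i < N" and y: "x \<le> y"
    have "((\<lambda>z. f i (z + of_real c)) has_field_derivative f (Suc i) (of_real (y + c))) (at (of_real y))"
      using Suc.prems(2)[of i "y + c"] i y c
      by (simp add: DERIV_shift[of "f i" _ "of_real y" "of_real c"])
    then show "(g i has_field_derivative g (Suc i) (of_real y)) (at (of_real y))"
      unfolding g_def using Suc.prems(2)[of i y] i y by (auto intro!: derivative_eq_intros)
  next
    fix y assume y: "x \<le> y"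
    define S where "S = complex_of_real ` {y..}"
    have "norm (f N (of_real y) - f N (of_real (y + c))) \<le> B * norm (complex_of_real y - of_real (y + c))"
    proof (rule field_differentiable_bound[where f' = "f (Suc N)" and S = S])
      show "convex S" unfolding S_def by (intro convex_linear_image) (auto intro: bounded_linear.linear bounded_linear_of_real)
      show "(f N has_field_derivative f (Suc N) z) (at z within S)" if "z \<in> S" for z
        using that y Suc.prems(2)[of N] by (auto simp: S_def intro: has_field_derivative_at_within)
      show "norm (f (Suc N) z) \<le> B" if "z \<in> S" for z
        using that y Suc.prems(3) by (auto simp: S_def)
    qed (use c in \<open>auto simp: S_def simp flip: of_real_add\<close>)
    then show "norm (g N (of_real y)) \<le> B * c" using c by (simp add: g_def)
  qed (use Suc.prems(1) in auto)
  then show ?case by (simp add: iterated_diff_Suc g_def c_def mult_ac)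
qed

text \<open>The gain of \<open>N\<close> in the exponent is what moves the half-plane of convergence
  from \<open>Re s > M\<close> to \<open>Re s > M - N\<close>.\<close>

lemma norm_iterated_diff_powr_le:
  assumes b: "\<And>j. j \<in> {1..N} \<Longrightarrow> b j > 0" and x: "x > 0" and s: "Re s + real N \<ge> 0"
  shows "norm (iterated_diff N b (\<lambda>z. z powr (-s)) (of_real x)) \<le>
    norm (pochhammer s N) * (\<Prod>j\<in>{1..N}. b j) * x powr (-(Re s + real N))"
proof -
  have "norm (iterated_diff N b (powr_derivs s 0) (of_real x)) \<le>
      (norm (pochhammer s N) * x powr (-(Re s + real N))) * (\<Prod>j\<in>{1..N}. b j)"
    using x s by (intro norm_iterated_diff_le has_field_derivative_powr_derivs norm_powr_derivs_le b) auto
  then show ?thesis by (simp add: powr_derivs_def[abs_def] mult_ac)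
qed

lemma norm_iterated_diff_Ln_le:
  assumes b: "\<And>j. j \<in> {1..N} \<Longrightarrow> b j > 0" and x: "x > 0" and N: "N > 0"
  shows "norm (iterated_diff N b Ln (of_real x)) \<le> fact (N - 1) * (\<Prod>j\<in>{1..N}. b j) * x powr (- real N)"
proof -
  \<comment> \<open>The derivative of order \<open>Suc i\<close> of \<open>Ln\<close> is that of
    order \<open>i\<close> of \<open>z powr (-1)\<close>; this shift explains the factor
    \<open>fact (N - 1)\<close>.\<close>
  define f where "f = (\<lambda>i. case i of 0 \<Rightarrow> Ln | Suc i \<Rightarrow> powr_derivs 1 i)"
  obtain n where n: "N = Suc n" using N by (cases N) auto
  have "norm (iterated_diff N b (f 0) (of_real x)) \<le>
      (fact (N - 1) * x powr (- real N)) * (\<Prod>j\<in>{1..N}. b j)"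
  proof (rule norm_iterated_diff_le)
    fix i y assume "i < N" "x \<le> y"
    show "(f i has_field_derivative f (Suc i) (of_real y)) (at (of_real y))"
    proof (cases i)
      case 0
      then show ?thesis using x \<open>x \<le> y\<close>
        by (auto simp: f_def powr_derivs_def powr_minus intro!: derivative_eq_intros)
    next
      case (Suc j)
      then show ?thesis using x \<open>x \<le> y\<close>
        by (auto simp: f_def intro!: has_field_derivative_powr_derivs)
    qed
  next
    fix y assume "x \<le> y"
    have "norm (pochhammer (1::complex) n) = fact n"
      by (simp flip: pochhammer_fact)
    then show "norm (f N (of_real y)) \<le> fact (N - 1) * x powr (- real N)"
      using norm_powr_derivs_le[of x y 1 n] x \<open>x \<le> y\<close> by (simp add: f_def n)
  qed (use b in auto)
  then show ?thesis by (simp add: f_def mult_ac)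
qed

section \<open>Meromorphic continuation of the Barnes zeta function\<close>

definition barnes_series :: "nat \<Rightarrow> (nat \<Rightarrow> real) \<Rightarrow> real \<Rightarrow> complex \<Rightarrow> complex" where
  "barnes_series M a w s = (\<Sum>\<^sub>\<infinity>n\<in>multi_indices M. of_real (w + lattice_sum M a n) powr (- s))"

lemma barnes_series_0: "barnes_series 0 a w s = of_real w powr (-s)"
  by (simp add: barnes_series_def multi_indices_def lattice_sum_def)

lemma summable_on_barnes_series:
  assumes "\<And>i. i \<in> {1..M} \<Longrightarrow> a i > 0" "w > 0" "Re s > real M"
  shows "(\<lambda>n. complex_of_real (w + lattice_sum M a n) powr (-s)) summable_on multi_indices M"
  using assms by (intro summable_on_lattice_bounded[where C = 1 and \<sigma> = "Re s"]) (auto simp: norm_powr_real_powr)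

lemma holomorphic_barnes_series:
  assumes a: "\<And>i. i \<in> {1..M} \<Longrightarrow> a i > 0" and w: "w > 0"
  shows "barnes_series M a w holomorphic_on {s. Re s > real M}"
proof -
  have "(\<lambda>s. \<Sum>\<^sub>\<infinity>n\<in>multi_indices M. of_real (w + lattice_sum M a n) powr (- s))
      holomorphic_on {s. Re s > real M - 0}"
    using w by (intro infsum_lattice_holomorphic(1)[where C = "\<lambda>_. 1"] a w)
      (auto simp: norm_powr_real_powr intro!: holomorphic_intros)
  then show ?thesis by (simp add: barnes_series_def[abs_def])
qed

section \<open>The difference equation in the last lattice direction\<close>

lemma multi_indices_Suc_upd:
  "n \<in> multi_indices M \<Longrightarrow> n(Suc M := k) \<in> multi_indices (Suc M)"
  "n \<in> multi_indices (Suc M) \<Longrightarrow> n(Suc M := k) \<in> multi_indices (Suc M)"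
  "n \<in> multi_indices (Suc M) \<Longrightarrow> n(Suc M := undefined) \<in> multi_indices M"
  "n \<in> multi_indices M \<Longrightarrow> n (Suc M) = undefined"
  by (auto simp: multi_indices_def PiE_iff extensional_def)

lemma lattice_sum_Suc:
  "lattice_sum (Suc M) a (n(Suc M := k)) = lattice_sum M a n + real k * a (Suc M)"
  "lattice_sum (Suc M) a n = lattice_sum M a n + real (n (Suc M)) * a (Suc M)"
  "lattice_sum M a (n(Suc M := k)) = lattice_sum M a n"
  by (auto simp: lattice_sum_def intro!: sum.cong)

text \<open>Split by the last coordinate: the indices where it is 0 give the series for
  \<open>M\<close>, and lowering a positive one by 1 shifts \<open>w\<close> by
  \<open>a (Suc M)\<close>.\<close>

lemma barnes_series_diff:
  assumes a: "\<And>i. i \<in> {1..Suc M} \<Longrightarrow> a i > 0" and w: "w > 0" and s: "Re s > real (Suc M)"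
  shows "barnes_series (Suc M) a w s - barnes_series (Suc M) a (w + a (Suc M)) s = barnes_series M a w s"
proof -
  define f where "f = (\<lambda>n. complex_of_real (w + lattice_sum (Suc M) a n) powr (-s))"
  define A0 A1 where "A0 = {n\<in>multi_indices (Suc M). n (Suc M) = 0}"
    and "A1 = {n\<in>multi_indices (Suc M). n (Suc M) > 0}"
  have A: "multi_indices (Suc M) = A0 \<union> A1" "A0 \<inter> A1 = {}" by (auto simp: A0_def A1_def)
  have f: "f summable_on multi_indices (Suc M)"
    unfolding f_def using a w s by (intro summable_on_barnes_series) auto
  have "barnes_series (Suc M) a w s = infsum f A0 + infsum f A1"
    unfolding barnes_series_def A(1)
    using infsum_Un_disjoint[OF summable_on_subset_banach[OF f] summable_on_subset_banach[OF f] A(2)] A(1)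
    by (auto simp: f_def)
  moreover have "barnes_series M a w s = infsum f A0"
    unfolding barnes_series_def
    \<comment> \<open>Members of \<open>multi_indices M\<close> are extensional, so their value at
      \<open>Suc M\<close> is \<open>undefined\<close>; it is exchanged for 0.\<close>
    by (rule infsum_reindex_bij_witness[of _ "\<lambda>n. n(Suc M := undefined)" "\<lambda>n. n(Suc M := 0)"])
       (auto simp: A0_def f_def lattice_sum_Suc multi_indices_Suc_upd fun_eq_iff)
  moreover have "barnes_series (Suc M) a (w + a (Suc M)) s = infsum f A1"
    unfolding barnes_series_def
    by (rule infsum_reindex_bij_witness[of _ "\<lambda>n. n(Suc M := n (Suc M) - 1)" "\<lambda>n. n(Suc M := Suc (n (Suc M)))"])
       (auto simp: A1_def f_def lattice_sum_Suc multi_indices_Suc_upd fun_eq_iff algebra_simps)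
  ultimately show ?thesis by simp
qed

section \<open>Cancelling the poles, and the recurrence in \<open>s\<close>\<close>

lemma has_sum_sum:
  fixes f :: "'j \<Rightarrow> 'i \<Rightarrow> 'a::topological_comm_monoid_add"
  assumes "\<And>j. j \<in> J \<Longrightarrow> (f j has_sum S j) A"
  shows "((\<lambda>i. \<Sum>j\<in>J. f j i) has_sum (\<Sum>j\<in>J. S j)) A"
  using assms by (induction J rule: infinite_finite_induct) (auto intro!: has_sum_add)

text \<open>\<open>(s - 1) \<cdots> (s - M)\<close>, which cancels the simple poles of the zeta function at \<open>1, \<dots>, M\<close>.\<close>

definition barnes_denominator :: "nat \<Rightarrow> complex \<Rightarrow> complex" where
  "barnes_denominator M s = pochhammer (s - of_nat M) M"

lemma barnes_denominator_nonzero_right: "Re s > real M \<Longrightarrow> barnes_denominator M s \<noteq> 0"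
  by (auto simp: barnes_denominator_def pochhammer_eq_0_iff eq_neg_iff_add_eq_0 dest!: arg_cong[of _ _ Re])

text \<open>This makes the zeta function regular at 0: the zeros of the denominator are
  \<open>1, \<dots>, M\<close>.\<close>

lemma barnes_denominator_0: "barnes_denominator M 0 \<noteq> 0"
proof
  assume "barnes_denominator M 0 = 0"
  then obtain k where k: "k < M" "- of_nat M = - (of_nat k :: complex)"
    by (auto simp: barnes_denominator_def pochhammer_eq_0_iff)
  then show False by simp
qed

lemma holomorphic_on_barnes_denominator [holomorphic_intros]:
  "f holomorphic_on A \<Longrightarrow> (\<lambda>s. barnes_denominator M (f s)) holomorphic_on A"
  unfolding barnes_denominator_def by (intro holomorphic_intros)

lemma barnes_denominator_Suc: "barnes_denominator (Suc M) s = barnes_denominator M (s - 1) * (s - 1)"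
  by (simp add: barnes_denominator_def pochhammer_Suc algebra_simps)

text \<open>Both sides equal \<open>pochhammer (s - of_nat M) (M + j)\<close>. This trades the
  denominator at \<open>s\<close> for the one at \<open>s + j\<close>, so that the recurrence
  involves only the normalised function \<open>G\<close>.\<close>

lemma barnes_denominator_shift:
  "barnes_denominator M s * pochhammer s j = pochhammer (s - of_nat M) j * barnes_denominator M (s + of_nat j)"
  using pochhammer_product'[of "s - of_nat M" M j] pochhammer_product'[of "s - of_nat M" j M]
  by (simp add: barnes_denominator_def algebra_simps)

text \<open>Summing the Taylor expansion of \<open>(x + h) powr (1 - s)\<close> over all lattice points \<open>x\<close>, with
  \<open>h = a (Suc M)\<close>, and cancelling the leading terms by the difference equation expresses the series at
  \<open>s\<close> through its values at \<open>s + 1, s + 2, \<dots>\<close>, the series for \<open>M\<close>, and a remainder that converges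
  further to the left.\<close>

lemma barnes_series_recurrence:
  fixes M K :: nat and a :: "nat \<Rightarrow> real" and w :: real
  defines "h \<equiv> a (Suc M)" and "G \<equiv> \<lambda>s. barnes_denominator (Suc M) s * barnes_series (Suc M) a w s"
  assumes a: "\<And>i. i \<in> {1..Suc M} \<Longrightarrow> a i > 0" and w: "w > 0" and s: "Re s > real M + 2"
  shows "of_real h * G s = barnes_denominator M (s - 1) *
     (barnes_series M a w (s - 1) +
      (\<Sum>\<^sub>\<infinity>n\<in>multi_indices (Suc M). powr_remainder (Suc K) h s (w + lattice_sum (Suc M) a n)))
    - (\<Sum>j\<in>{1..K}. (-1) ^ j * pochhammer (s - of_nat (Suc M)) j * of_real h ^ Suc j / fact (Suc j) * G (s + of_nat j))"
proof -
  let ?Z = "barnes_series (Suc M) a w" and ?I = "multi_indices (Suc M)"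
  let ?x = "\<lambda>n. w + lattice_sum (Suc M) a n"
  define R where "R = (\<Sum>\<^sub>\<infinity>n\<in>?I. powr_remainder (Suc K) h s (?x n))"
  define c where "c = (\<lambda>i. (-1) ^ i * pochhammer (s - 1) i * of_real h ^ i / fact i)"
  have h: "h > 0" using a by (simp add: h_def)
  \<comment> \<open>Since \<open>Re s > M + 2\<close>, even the leading argument
    \<open>s - 1\<close> lies in the half-plane \<open>Re s > M + 1\<close> of convergence.\<close>
  have Z: "((\<lambda>n. complex_of_real (?x n) powr (1 - s - of_nat i)) has_sum ?Z (s - 1 + of_nat i)) ?I" for i
    using has_sum_infsum[OF summable_on_barnes_series[of "Suc M" a w "s - 1 + of_nat i"]] a w s
    by (simp add: barnes_series_def algebra_simps)
  have Rs: "((\<lambda>n. powr_remainder (Suc K) h s (?x n)) has_sum R) ?I"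
    unfolding R_def
    using a w s h
    by (intro has_sum_infsum summable_on_lattice_bounded[where \<sigma> = "Re s + real (Suc K)", OF _ _ _ norm_powr_remainder_le]) auto
  have "((\<lambda>n. (\<Sum>i\<le>Suc K. c i * of_real (?x n) powr (1 - s - of_nat i)) + powr_remainder (Suc K) h s (?x n))
      has_sum ((\<Sum>i\<le>Suc K. c i * ?Z (s - 1 + of_nat i)) + R)) ?I"
    by (intro has_sum_add has_sum_sum has_sum_cmult_right Z Rs)
  moreover have "(\<Sum>i\<le>Suc K. c i * of_real (?x n) powr (1 - s - of_nat i)) + powr_remainder (Suc K) h s (?x n)
      = complex_of_real (w + h + lattice_sum (Suc M) a n) powr (- (s - 1))" for n
    unfolding powr_remainder_def c_def by (simp add: mult_ac add_ac del: sum.atMost_Suc)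
  ultimately have "barnes_series (Suc M) a (w + h) (s - 1) = (\<Sum>i\<le>Suc K. c i * ?Z (s - 1 + of_nat i)) + R"
    unfolding barnes_series_def[of "Suc M" a "w + h"] by (simp add: infsumI del: sum.atMost_Suc)
  also have "(\<Sum>i\<le>Suc K. c i * ?Z (s - 1 + of_nat i)) = ?Z (s - 1) + (\<Sum>j\<le>K. c (Suc j) * ?Z (s + of_nat j))"
    by (subst sum.atMost_Suc_shift) (simp add: c_def)
  finally have "?Z (s - 1) - barnes_series (Suc M) a (w + h) (s - 1) + R = - (\<Sum>j\<le>K. c (Suc j) * ?Z (s + of_nat j))"
    by simp
  also have "?Z (s - 1) - barnes_series (Suc M) a (w + h) (s - 1) = barnes_series M a w (s - 1)"
    unfolding h_def using a w s by (intro barnes_series_diff) auto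
  finally have "barnes_series M a w (s - 1) + R = - (\<Sum>j\<le>K. c (Suc j) * ?Z (s + of_nat j))" .
  then have "barnes_denominator M (s - 1) * (barnes_series M a w (s - 1) + R) =
      (\<Sum>j\<le>K. - (barnes_denominator M (s - 1) * c (Suc j) * ?Z (s + of_nat j)))"
    by (simp add: sum_distrib_left sum_negf mult_ac)
  also have "\<dots> = (\<Sum>j\<le>K. (-1) ^ j * pochhammer (s - of_nat (Suc M)) j * of_real h ^ Suc j / fact (Suc j) * G (s + of_nat j))"
  proof (rule sum.cong)
    fix j
    have "barnes_denominator M (s - 1) * pochhammer (s - 1) (Suc j) = barnes_denominator (Suc M) s * pochhammer s j"
      by (simp add: barnes_denominator_Suc pochhammer_rec)
    also have "\<dots> = pochhammer (s - of_nat (Suc M)) j * barnes_denominator (Suc M) (s + of_nat j)"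
      by (rule barnes_denominator_shift)
    finally have eq: "barnes_denominator M (s - 1) * pochhammer (s - 1) (Suc j) =
      pochhammer (s - of_nat (Suc M)) j * barnes_denominator (Suc M) (s + of_nat j)" .
    have "- (barnes_denominator M (s - 1) * c (Suc j) * ?Z (s + of_nat j)) =
      (barnes_denominator M (s - 1) * pochhammer (s - 1) (Suc j)) *
        ((-1) ^ j * of_real h ^ Suc j / fact (Suc j) * ?Z (s + of_nat j))"
      by (simp add: c_def mult_ac del: fact_Suc)
    then show "- (barnes_denominator M (s - 1) * c (Suc j) * ?Z (s + of_nat j)) =
      (-1) ^ j * pochhammer (s - of_nat (Suc M)) j * of_real h ^ Suc j / fact (Suc j) * G (s + of_nat j)"
      by (simp only: eq) (simp add: G_def mult_ac del: fact_Suc)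
  qed simp
  \<comment> \<open>The term \<open>j = 0\<close> is the one for which the recurrence is
    solved.\<close>
  also have "\<dots> = of_real h * G s + (\<Sum>j\<in>{1..K}. (-1) ^ j * pochhammer (s - of_nat (Suc M)) j * of_real h ^ Suc j / fact (Suc j) * G (s + of_nat j))"
    by (simp add: atMost_atLeast0 sum.atLeast_Suc_atMost del: fact_Suc)
  finally show ?thesis by (simp add: R_def)
qed

section \<open>Extension to the left, half-plane by half-plane\<close>

lemma holomorphic_half_plane_eq:
  assumes "f holomorphic_on {s. Re s > c}" "g holomorphic_on {s. Re s > c}"
    and "\<And>s. Re s > d \<Longrightarrow> f s = g s" "Re z > c"
  shows "f z = g z"
proof (rule analytic_continuation_open[of "{s. Re s > max c d}" "{s. Re s > c}" f g])
  show "open {s. Re s > max c d}" by (rule open_halfspace_Re_gt)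
  have "complex_of_real (max c d + 1) \<in> {s. Re s > max c d}" by (simp del: max_less_iff_conj)
  then show "{s. Re s > max c d} \<noteq> {}" by blast
  show "connected {s. Re s > c}" by (intro convex_connected convex_halfspace_Re_gt)
qed (use assms in \<open>auto intro: open_halfspace_Re_gt\<close>)

text \<open>By the identity theorem, extensions to different half-planes agree where both are
  defined, so they glue to an entire function.\<close>

lemma entire_from_half_planes:
  fixes c :: real
  assumes "\<And>L::nat. \<exists>G. G holomorphic_on {s. Re s > c - real L} \<and> (\<forall>s. Re s > c \<longrightarrow> G s = F s)"
  shows "\<exists>E. E holomorphic_on UNIV \<and> (\<forall>s. Re s > c \<longrightarrow> E s = F s)"
proof -
  define G where "G = (\<lambda>L::nat. SOME G. G holomorphic_on {s. Re s > c - real L} \<and> (\<forall>s. Re s > c \<longrightarrow> G s = F s))"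
  have GG: "G L holomorphic_on {s. Re s > c - real L} \<and> (\<forall>s. Re s > c \<longrightarrow> G L s = F s)" for L
    unfolding G_def using someI_ex[OF assms[of L]] .
  have G1: "G L holomorphic_on {s. Re s > c - real L}" for L using GG[of L] by (rule conjunct1)
  have G2: "G L s = F s" if "Re s > c" for L s using GG[of L] that by simp
  have mono: "G L s = G L' s" if s: "Re s > c - real L" and L: "L \<le> L'" for L L' s
  proof (rule holomorphic_half_plane_eq[of "G L" "c - real L" "G L'" c, OF G1 _ _ s])
    show "G L' holomorphic_on {s. Re s > c - real L}"
      by (rule holomorphic_on_subset[OF G1]) (use L in auto)
    show "G L s = G L' s" if "Re s > c" for s by (simp only: G2[OF that])
  qed
  have eq: "G L s = G L' s" if "Re s > c - real L" "Re s > c - real L'" for L L' s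
  proof (cases "L \<le> L'")
    case True
    then show ?thesis by (rule mono[OF that(1)])
  next
    case False
    then show ?thesis using mono[OF that(2), of L] by simp
  qed
  \<comment> \<open>Selects a half-plane containing \<open>s\<close>; the added 1 makes the
    inequality strict.\<close>
  define l where "l = (\<lambda>s. nat \<lceil>c - Re s\<rceil> + 1)"
  have l: "Re s > c - real (l s)" for s
    unfolding l_def using real_nat_ceiling_ge[of "c - Re s"] by simp
  define E where "E = (\<lambda>s. G (l s) s)"
  have E: "E s = G L s" if "Re s > c - real L" for s L
    unfolding E_def by (rule eq[OF l that])
  have "E field_differentiable at z" for z
  proof -
    have "E holomorphic_on {s. Re s > c - real (l z)}"
      by (rule holomorphic_transform[OF G1[of "l z"]]) (rule E[symmetric], simp)
    then show ?thesis
      by (rule holomorphic_on_imp_differentiable_at) (simp_all add: open_halfspace_Re_gt l)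
  qed
  then have "E holomorphic_on UNIV" by (simp add: holomorphic_on_def)
  moreover have "E s = F s" if "Re s > c" for s
    using E[of 0 s] G2[OF that] that by simp
  ultimately show ?thesis by blast
qed

text \<open>Outer induction on \<open>M\<close>, inner induction on the number \<open>L\<close> of
  unit strips gained. In the new strip the recurrence uses \<open>G\<close> only at
  \<open>s + 1, \<dots>, s + L\<close>, where it is already known, the entire function for
  \<open>M\<close>, and a remainder series that converges there.\<close>

lemma barnes_entire_extension:
  assumes "\<And>i. i \<in> {1..M} \<Longrightarrow> a i > 0" and w: "w > 0"
  shows "\<exists>E. E holomorphic_on UNIV \<and>
           (\<forall>s. Re s > real M \<longrightarrow> E s = barnes_denominator M s * barnes_series M a w s)"
  using assms(1)
proof (induction M)
  case 0
  show ?case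
    using w by (intro exI[of _ "\<lambda>s. of_real w powr (-s)"])
      (auto simp: barnes_denominator_def barnes_series_0 intro!: holomorphic_intros)
next
  case (Suc M)
  note a = Suc.prems
  define h where "h = a (Suc M)"
  have h: "h > 0" using a by (simp add: h_def)
  obtain E where E: "E holomorphic_on UNIV"
      "\<And>s. Re s > real M \<Longrightarrow> E s = barnes_denominator M s * barnes_series M a w s"
    using Suc by auto
  define F where "F = (\<lambda>s. barnes_denominator (Suc M) s * barnes_series (Suc M) a w s)"
  have F: "F holomorphic_on {s. Re s > real (Suc M)}"
    unfolding F_def using a w by (intro holomorphic_intros holomorphic_barnes_series) auto
  have "\<exists>G. G holomorphic_on {s. Re s > real (Suc M) - real L} \<and> (\<forall>s. Re s > real (Suc M) \<longrightarrow> G s = F s)" for L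
  proof (induction L)
    case 0
    then show ?case using F by auto
  next
    case (Suc L)
    then obtain G where G: "G holomorphic_on {s. Re s > real (Suc M) - real L}"
        "\<And>s. Re s > real (Suc M) \<Longrightarrow> G s = F s" by blast
    define R where "R = (\<lambda>s. \<Sum>\<^sub>\<infinity>n\<in>multi_indices (Suc M). powr_remainder (Suc L) h s (w + lattice_sum (Suc M) a n))"
    define t where "t = (\<lambda>s j. (-1) ^ j * pochhammer (s - of_nat (Suc M)) j * of_real h ^ Suc j / fact (Suc j) * G (s + of_nat j))"
    \<comment> \<open>The recurrence with \<open>K = L\<close>, solved for the value at
      \<open>s\<close>.\<close>
    define G' where "G' = (\<lambda>s. (E (s - 1) + barnes_denominator M (s - 1) * R s - (\<Sum>j\<in>{1..L}. t s j)) / of_real h)"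
    let ?U = "{s. Re s > real (Suc M) - real (Suc L)}"
    have R: "R holomorphic_on ?U"
      unfolding R_def
    proof (rule infsum_lattice_holomorphic(1)[where f = "powr_remainder (Suc L) h" and K = "real (Suc L)"])
      have "continuous_on UNIV (\<lambda>s. pochhammer (s - 1 :: complex) (Suc (Suc L)))"
        by (rule holomorphic_on_imp_continuous_on) (intro holomorphic_intros)
      then show "continuous_on UNIV (\<lambda>s. norm (pochhammer (s - 1 :: complex) (Suc (Suc L))) * h ^ Suc (Suc L) / fact (Suc L))"
        by (intro continuous_on_mult continuous_on_divide continuous_on_norm continuous_on_const) simp_all
    next
      fix s x assume "w \<le> x" "s \<in> ?U"
      then show "norm (powr_remainder (Suc L) h s x) \<le>
          norm (pochhammer (s - 1) (Suc (Suc L))) * h ^ Suc (Suc L) / fact (Suc L) * x powr (-(Re s + real (Suc L)))"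
        using w h by (intro norm_powr_remainder_le) auto
    next
      fix x assume "w \<le> x"
      then show "(\<lambda>s. powr_remainder (Suc L) h s x) holomorphic_on ?U"
        using w h by (intro holomorphic_on_powr_remainder) auto
    qed (use a w in auto)
    have Gj: "(\<lambda>s. G (s + of_nat j)) holomorphic_on ?U" if "j \<in> {1..L}" for j
      using that by (intro holomorphic_on_compose_gen[OF _ G(1), unfolded o_def] holomorphic_intros) auto
    have E': "(\<lambda>s. E (s - 1)) holomorphic_on ?U"
      by (intro holomorphic_on_compose_gen[OF _ E(1), unfolded o_def] holomorphic_intros) auto
    have G': "G' holomorphic_on ?U"
      unfolding G'_def t_def using h by (intro holomorphic_intros R E' Gj) auto
    \<comment> \<open>The recurrence is available for \<open>Re s > M + 2\<close>; the identity
      theorem then gives agreement for \<open>Re s > M + 1\<close>.\<close>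
    have "G' s = F s" if "Re s > real M + 2" for s
    proof -
      have "of_real h * F s = E (s - 1) + barnes_denominator M (s - 1) * R s - (\<Sum>j\<in>{1..L}. t s j)"
        using barnes_series_recurrence[where K = L, OF a w that] that G(2) E(2)[of "s - 1"]
        by (simp add: F_def R_def t_def h_def distrib_left del: fact_Suc)
      also have "\<dots> = of_real h * G' s" using h by (simp add: G'_def)
      finally have "of_real h * F s = of_real h * G' s" .
      then show ?thesis using h by simp
    qed
    moreover have "G' holomorphic_on {s. Re s > real (Suc M)}"
      by (rule holomorphic_on_subset[OF G']) auto
    ultimately have "G' s = F s" if "Re s > real (Suc M)" for s
      using F that holomorphic_half_plane_eq[of G' "real (Suc M)" F "real M + 2"] by blast
    with G' show ?case by blast
  qed
  then show ?case unfolding F_def by (rule entire_from_half_planes)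
qed

text \<open>The identity theorem makes \<open>f\<close> and \<open>g\<close> agree on a punctured
  neighbourhood of every \<open>z\<close>. They then share poles and limits at \<open>z\<close>, and
  the normalisation fixes the value there.\<close>

lemma nicely_meromorphic_eq:
  assumes f: "f nicely_meromorphic_on UNIV" and g: "g nicely_meromorphic_on UNIV"
    and S: "open S" "S \<noteq> {}" and eq: "\<And>s. s \<in> S \<Longrightarrow> f s = g s"
  shows "f = g"
proof
  fix z
  have "(\<lambda>s. f s - g s) meromorphic_on UNIV"
    using f g by (intro meromorphic_intros) (auto simp: nicely_meromorphic_on_def)
  note h = this
  obtain z0 where z0: "z0 \<in> S" using S by auto
  have "eventually (\<lambda>s. s \<in> S) (at z0)" using S z0 by (simp add: eventually_at_in_open')
  \<comment> \<open>Poles of \<open>f\<close> and \<open>g\<close> may cancel in the difference and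
    leave a value other than the limit, so the difference is normalised first.\<close>
  moreover have "eventually (\<lambda>s. remove_sings (\<lambda>s. f s - g s) s = f s - g s) (at z0)"
    by (intro eventually_remove_sings_eq_at meromorphic_on_isolated_singularity[OF meromorphic_on_subset[OF h]]) auto
  ultimately have "eventually (\<lambda>s. remove_sings (\<lambda>s. f s - g s) s = 0) (at z0)"
    by eventually_elim (simp add: eq)
  then have "remove_sings (\<lambda>s. f s - g s) w = 0" for w
    using remove_sings_nicely_meromorphic[OF h]
    by (intro frequently_eq_meromorphic_imp_constant[of _ 0 z0 UNIV]) (auto intro: eventually_frequently)
  moreover have "eventually (\<lambda>s. remove_sings (\<lambda>s. f s - g s) s = f s - g s) (at z)"
    by (intro eventually_remove_sings_eq_at meromorphic_on_isolated_singularity[OF meromorphic_on_subset[OF h]]) auto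
  ultimately have ev: "eventually (\<lambda>s. f s = g s) (at z)" by simp
  have pole: "is_pole f z \<longleftrightarrow> is_pole g z" using ev by (intro is_pole_cong) auto
  have lim: "f \<midarrow>z\<rightarrow> l \<longleftrightarrow> g \<midarrow>z\<rightarrow> l" for l using ev by (intro tendsto_cong)
  have fg: "(is_pole f z \<and> f z = 0) \<or> f \<midarrow>z\<rightarrow> f z" "(is_pole g z \<and> g z = 0) \<or> g \<midarrow>z\<rightarrow> g z"
    using f g by (auto simp: nicely_meromorphic_on_def)
  have nl: "\<not> f \<midarrow>z\<rightarrow> l" if "is_pole f z" for l
    using that not_tendsto_and_filterlim_at_infinity[of "at z" f l] by (auto simp: is_pole_def)
  show "f z = g z"
  proof (cases "is_pole f z")
    case True
    then show ?thesis using fg nl[OF True] lim pole by auto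
  next
    case False
    then have "f \<midarrow>z\<rightarrow> f z" "f \<midarrow>z\<rightarrow> g z" using fg pole lim by auto
    then show ?thesis by (intro tendsto_unique[of "at z" f]) auto
  qed
qed

text \<open>The quotient of \<open>E\<close> by the denominator, normalised by
  \<open>remove_sings\<close>, satisfies the definite description, and uniqueness identifies it with
  \<open>barnes_zeta\<close>. Near 0 nothing is altered by \<open>remove_sings\<close>, as the
  denominator does not vanish at 0.\<close>

lemma barnes_zeta_near_0:
  assumes a: "\<And>i. i \<in> {1..M} \<Longrightarrow> a i > 0" and w: "w > 0"
  obtains E where "E holomorphic_on UNIV"
    and "\<And>s. Re s > real M \<Longrightarrow> E s = barnes_denominator M s * barnes_series M a w s"
    and "eventually (\<lambda>s. barnes_zeta M a (of_real w) s = E s / barnes_denominator M s) (nhds 0)"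
proof -
  obtain E where E: "E holomorphic_on UNIV"
      "\<And>s. Re s > real M \<Longrightarrow> E s = barnes_denominator M s * barnes_series M a w s"
    using barnes_entire_extension[of M a w] a w by auto
  define q where "q = (\<lambda>s. E s / barnes_denominator M s)"
  define f where "f = remove_sings q"
  have D: "barnes_denominator M holomorphic_on UNIV"
    by (rule holomorphic_on_barnes_denominator) (rule holomorphic_on_ident)
  have "q meromorphic_on UNIV"
    unfolding q_def using E(1) D
    by (intro meromorphic_intros analytic_on_imp_meromorphic_on) (auto simp: analytic_on_open)
  then have nice: "f nicely_meromorphic_on UNIV"
    unfolding f_def by (rule remove_sings_nicely_meromorphic)
  have an: "q analytic_on {s}" if "barnes_denominator M s \<noteq> 0" for s
    unfolding q_def using E(1) D that
    by (intro analytic_on_divide) (auto simp: analytic_on_open intro: analytic_on_subset[of _ UNIV])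
  have val: "f s = (\<Sum>\<^sub>\<infinity>k\<in>multi_indices M. (of_real w + of_real (lattice_sum M a k)) powr (- s))"
    if "Re s > real M" for s
  proof -
    have "f s = q s" unfolding f_def
      by (intro remove_sings_at_analytic an barnes_denominator_nonzero_right that)
    also have "\<dots> = barnes_series M a w s"
      using E(2)[OF that] barnes_denominator_nonzero_right[OF that] by (simp add: q_def)
    finally show ?thesis by (simp add: barnes_series_def)
  qed
  have "barnes_zeta M a (of_real w) = f"
    unfolding barnes_zeta_def
  proof (rule the_equality)
    fix g assume g: "g nicely_meromorphic_on UNIV \<and> (\<forall>s. Re s > real M \<longrightarrow> g s =
      (\<Sum>\<^sub>\<infinity>k\<in>multi_indices M. (of_real w + of_real (lattice_sum M a k)) powr (- s)))"
    have "complex_of_real (real M + 1) \<in> {s. Re s > real M}" by simp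
    then have "{s. Re s > real M} \<noteq> {}" by blast
    then show "g = f"
      using g nice val by (intro nicely_meromorphic_eq[of _ _ "{s. Re s > real M}"] open_halfspace_Re_gt) auto
  qed (use nice val in auto)
  moreover have "eventually (\<lambda>s. f s = q s) (nhds 0)"
    unfolding f_def by (intro eventually_remove_sings_eq_nhds an barnes_denominator_0)
  ultimately show ?thesis using that[OF E] by (simp add: q_def)
qed

section \<open>The atom at 1\<close>

text \<open>The differenced series \<open>T\<close> is holomorphic on a half-plane containing 0 and
  agrees near 0 with the alternating sum of continued zeta functions. Its derivative at 0 is
  therefore computed both termwise and through \<open>barnes_zeta\<close>.\<close>

lemma has_sum_deriv_barnes_zeta:
  fixes x :: real
  assumes a: "\<And>i. i \<in> {1..M} \<Longrightarrow> a i > 0" and b: "\<And>j. j \<in> {1..N} \<Longrightarrow> b j > 0"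
    and x: "x > 0" and MN: "M < N"
  shows "((\<lambda>n. - iterated_diff N b Ln (of_real (x + lattice_sum M a n))) has_sum
           iterated_diff N b (\<lambda>w. deriv (barnes_zeta M a w) 0) (of_real x)) (multi_indices M)"
proof -
  let ?I = "multi_indices M"
  define w where "w = (\<lambda>J. x + (\<Sum>j\<in>J. b j))"
  have bJ: "(\<Sum>j\<in>J. b j) \<ge> 0" if "J \<in> Pow {1..N}" for J
    using that b by (intro sum_nonneg) (auto simp: less_imp_le subset_iff)
  have w: "w J > 0" if "J \<in> Pow {1..N}" for J using bJ[OF that] x by (simp add: w_def)
  define good where "good = (\<lambda>J E. E holomorphic_on UNIV \<and>
      (\<forall>s. Re s > real M \<longrightarrow> E s = barnes_denominator M s * barnes_series M a (w J) s) \<and>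
      eventually (\<lambda>s. barnes_zeta M a (of_real (w J)) s = E s / barnes_denominator M s) (nhds 0))"
  define E where "E = (\<lambda>J. SOME E. good J E)"
  have good: "good J (E J)" if J: "J \<in> Pow {1..N}" for J
  proof -
    obtain E' where "E' holomorphic_on UNIV"
      and "\<And>s. Re s > real M \<Longrightarrow> E' s = barnes_denominator M s * barnes_series M a (w J) s"
      and "eventually (\<lambda>s. barnes_zeta M a (of_real (w J)) s = E' s / barnes_denominator M s) (nhds 0)"
      using barnes_zeta_near_0[of M a "w J", OF a w[OF J]] by blast
    then have "good J E'" by (simp add: good_def)
    then show ?thesis unfolding E_def by (rule someI[of "good J"])
  qed
  have E: "E J holomorphic_on UNIV"
      "\<And>s. Re s > real M \<Longrightarrow> E J s = barnes_denominator M s * barnes_series M a (w J) s"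
      "eventually (\<lambda>s. barnes_zeta M a (of_real (w J)) s = E J s / barnes_denominator M s) (nhds 0)"
    if "J \<in> Pow {1..N}" for J
    using good[OF that] by (simp_all add: good_def)
  define f where "f = (\<lambda>s y. iterated_diff N b (\<lambda>z. z powr (-s)) (of_real y))"
  define T where "T = (\<lambda>s. \<Sum>\<^sub>\<infinity>n\<in>?I. f s (x + lattice_sum M a n))"
  let ?U = "{s. Re s > real M - real N}"
  have pos: "complex_of_real y + of_real (\<Sum>j\<in>J. b j) \<noteq> 0" if "y \<ge> x" "J \<in> Pow {1..N}" for y J
  proof -
    have "y + (\<Sum>j\<in>J. b j) \<noteq> 0" using x that bJ[of J] by linarith
    then show ?thesis by (simp only: of_real_add[symmetric] of_real_eq_0_iff not_False_eq_True)
  qed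
  have hol: "(\<lambda>s. f s y) holomorphic_on ?U" if "x \<le> y" for y
    unfolding f_def iterated_diff_def using pos[OF that] by (intro holomorphic_intros)
  have cont: "continuous_on UNIV (\<lambda>s::complex. norm (pochhammer s N) * (\<Prod>j\<in>{1..N}. b j))"
    by (intro continuous_on_mult continuous_on_norm continuous_on_const
        holomorphic_on_imp_continuous_on holomorphic_intros)
  have bd: "norm (f s y) \<le> norm (pochhammer s N) * (\<Prod>j\<in>{1..N}. b j) * y powr (-(Re s + real N))"
    if "x \<le> y" "s \<in> ?U" for s y
    unfolding f_def using that x MN by (intro norm_iterated_diff_powr_le b) auto
  have T: "T holomorphic_on ?U"
    unfolding T_def by (rule infsum_lattice_holomorphic(1)[where f = f, OF a x hol cont bd])
  have T': "((\<lambda>n. deriv (\<lambda>s. f s (x + lattice_sum M a n)) 0) has_sum deriv T 0) ?I"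
    unfolding T_def
    by (rule infsum_lattice_holomorphic(2)[where f = f, OF a x hol cont bd]) (use MN in auto)
  have "barnes_denominator M s * T s = (\<Sum>J\<in>Pow {1..N}. (-1) ^ card J * E J s)" if s: "Re s > real M" for s
  proof -
    have "((\<lambda>n. f s (x + lattice_sum M a n)) has_sum
       (\<Sum>J\<in>Pow {1..N}. (-1) ^ card J * barnes_series M a (w J) s)) ?I"
      unfolding f_def iterated_diff_def
    proof (intro has_sum_sum has_sum_cmult_right)
      fix J assume J: "J \<in> Pow {1..N}"
      have "((\<lambda>n. complex_of_real (w J + lattice_sum M a n) powr (-s)) has_sum barnes_series M a (w J) s) ?I"
        unfolding barnes_series_def using a w[OF J] s
        by (intro has_sum_infsum summable_on_barnes_series) auto
      then show "((\<lambda>n. (complex_of_real (x + lattice_sum M a n) + of_real (\<Sum>j\<in>J. b j)) powr (-s))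
          has_sum barnes_series M a (w J) s) ?I"
        by (simp add: w_def add_ac)
    qed
    then have "T s = (\<Sum>J\<in>Pow {1..N}. (-1) ^ card J * barnes_series M a (w J) s)"
      unfolding T_def by (rule infsumI)
    then show ?thesis by (simp add: sum_distrib_left E(2)[OF _ s] mult_ac)
  qed
  moreover have "(\<lambda>s. barnes_denominator M s * T s) holomorphic_on ?U"
    by (intro holomorphic_intros T)
  moreover have "(\<lambda>s. \<Sum>J\<in>Pow {1..N}. (-1) ^ card J * E J s) holomorphic_on ?U"
    by (intro holomorphic_on_sum holomorphic_on_mult holomorphic_on_const holomorphic_on_subset[OF E(1)]) auto
  \<comment> \<open>Multiplying by the denominator made both sides holomorphic on \<open>?U\<close>,
    so the identity spreads there from \<open>Re s > M\<close>. Since \<open>M < N\<close>,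
    \<open>?U\<close> contains 0.\<close>
  ultimately have DT: "barnes_denominator M s * T s = (\<Sum>J\<in>Pow {1..N}. (-1) ^ card J * E J s)"
    if "s \<in> ?U" for s
    using that holomorphic_half_plane_eq[of "\<lambda>s. barnes_denominator M s * T s" "real M - real N"
        "\<lambda>s. \<Sum>J\<in>Pow {1..N}. (-1) ^ card J * E J s" "real M" s] by blast
  have D: "barnes_denominator M holomorphic_on UNIV"
    by (rule holomorphic_on_barnes_denominator) (rule holomorphic_on_ident)
  then have "isCont (barnes_denominator M) 0"
    using holomorphic_on_imp_continuous_on continuous_on_eq_continuous_at open_UNIV by blast
  then have ev0: "eventually (\<lambda>s. barnes_denominator M s \<noteq> 0) (nhds 0)"
    using barnes_denominator_0 tendsto_imp_eventually_ne
    unfolding isCont_def tendsto_at_iff_tendsto_nhds by blast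
  have evU: "eventually (\<lambda>s. s \<in> ?U) (nhds 0)"
    using MN by (intro eventually_nhds_in_open open_halfspace_Re_gt) auto
  have evE: "eventually (\<lambda>s. \<forall>J\<in>Pow {1..N}. barnes_zeta M a (of_real (w J)) s = E J s / barnes_denominator M s) (nhds 0)"
    by (rule eventually_ball_finite) (use E(3) in auto)
  have ev: "eventually (\<lambda>s. (\<Sum>J\<in>Pow {1..N}. (-1) ^ card J * barnes_zeta M a (of_real (w J)) s) = T s) (nhds 0)"
    using ev0 evU evE
  proof eventually_elim
    case (elim s)
    have "(\<Sum>J\<in>Pow {1..N}. (-1) ^ card J * barnes_zeta M a (of_real (w J)) s) =
        (\<Sum>J\<in>Pow {1..N}. (-1) ^ card J * E J s) / barnes_denominator M s"
      using elim(3) by (simp add: sum_divide_distrib)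
    also have "\<dots> = T s" using elim(1) DT[OF elim(2)] by (simp add: field_simps)
    finally show ?case .
  qed
  have diffb: "(barnes_zeta M a (of_real (w J)) has_field_derivative deriv (barnes_zeta M a (of_real (w J))) 0) (at 0)"
    if J: "J \<in> Pow {1..N}" for J
  proof -
    have "(\<lambda>s. E J s / barnes_denominator M s) field_differentiable at 0"
      using barnes_denominator_0 E(1)[OF J] D
      by (intro field_differentiable_divide) (auto simp: holomorphic_on_def)
    then obtain d where "((\<lambda>s. E J s / barnes_denominator M s) has_field_derivative d) (at 0)"
      by (auto simp: field_differentiable_def)
    then have "(barnes_zeta M a (of_real (w J)) has_field_derivative d) (at 0)"
      using E(3)[OF J] by (subst DERIV_cong_ev[OF refl _ refl])
    then show ?thesis by (simp add: DERIV_imp_deriv)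
  qed
  have "deriv T 0 = deriv (\<lambda>s. \<Sum>J\<in>Pow {1..N}. (-1) ^ card J * barnes_zeta M a (of_real (w J)) s) 0"
    using ev by (intro deriv_cong_ev) (auto elim: eventually_mono)
  also have "\<dots> = (\<Sum>J\<in>Pow {1..N}. (-1) ^ card J * deriv (barnes_zeta M a (of_real (w J))) 0)"
    by (intro DERIV_imp_deriv DERIV_sum DERIV_cmult diffb)
  also have "\<dots> = iterated_diff N b (\<lambda>w. deriv (barnes_zeta M a w) 0) (of_real x)"
    by (simp add: iterated_diff_def w_def)
  finally have dT: "deriv T 0 = iterated_diff N b (\<lambda>w. deriv (barnes_zeta M a w) 0) (of_real x)" .
  have "deriv (\<lambda>s. f s (x + lattice_sum M a n)) 0 = - iterated_diff N b Ln (of_real (x + lattice_sum M a n))" for n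
  proof -
    define y where "y = x + lattice_sum M a n"
    have y: "x \<le> y" using lattice_sum_nonneg[of M a n] a by (simp add: y_def)
    \<comment> \<open>At \<open>s = 0\<close> the derivative of \<open>z powr (-s)\<close> in
      \<open>s\<close> is \<open>- Ln z\<close>.\<close>
    have "((\<lambda>s. f s y) has_field_derivative (\<Sum>J\<in>Pow {1..N}. (-1) ^ card J *
        (- Ln (of_real y + of_real (\<Sum>j\<in>J. b j))))) (at 0)"
      unfolding f_def iterated_diff_def
    proof (intro DERIV_sum DERIV_cmult)
      fix J assume J: "J \<in> Pow {1..N}"
      define z where "z = complex_of_real y + of_real (\<Sum>j\<in>J. b j)"
      have "z \<noteq> 0" using pos[OF y J] by (simp add: z_def)
      then have "((\<lambda>s. z powr (-s)) has_field_derivative - Ln z) (at 0)"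
        unfolding powr_def by (auto intro!: derivative_eq_intros)
      then show "((\<lambda>s. (complex_of_real y + of_real (\<Sum>j\<in>J. b j)) powr (-s)) has_field_derivative
         - Ln (of_real y + of_real (\<Sum>j\<in>J. b j))) (at 0)" by (simp add: z_def)
    qed
    then show ?thesis
      unfolding y_def[symmetric] by (simp add: DERIV_imp_deriv iterated_diff_def sum_negf)
  qed
  then show ?thesis using T' dT by simp
qed

section \<open>Limit of the moments and the infinite product\<close>

lemma barnes_S_eq_iterated_diff: "barnes_S N b h q = iterated_diff N b h (q + of_real (b 0))"
  by (simp add: barnes_S_def iterated_diff_def)

lemma has_sum_barnes_S:
  fixes q :: real
  assumes a: "\<And>i. i \<in> {1..M} \<Longrightarrow> a i > 0" and b: "\<And>j. j \<in> {0..N} \<Longrightarrow> b j > 0"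
    and q: "q \<ge> 0" and MN: "M < N"
  shows "((\<lambda>n. - iterated_diff N b Ln (of_real (q + b 0 + lattice_sum M a n))) has_sum
           barnes_S N b (barnes_L M a) (of_real q)) (multi_indices M)"
proof (cases "M = 0")
  \<comment> \<open>Here \<open>barnes_L\<close> is \<open>- Ln\<close> by definition and the
    lattice is a single point, so the sum has one term.\<close>
  case True
  then have "barnes_L M a = (\<lambda>w. - Ln w)" by (simp add: barnes_L_def[abs_def])
  then have "barnes_S N b (barnes_L M a) (of_real q) = - iterated_diff N b Ln (of_real (q + b 0))"
    by (simp add: barnes_S_eq_iterated_diff iterated_diff_def sum_negf)
  then show ?thesis using True
    by (intro has_sum_finiteI) (simp_all add: multi_indices_def lattice_sum_def)
next
  case False
  then have "barnes_L M a = (\<lambda>w. deriv (barnes_zeta M a w) 0)" by (simp add: barnes_L_def[abs_def])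
  moreover have "q + b 0 > 0" using q b[of 0] by simp
  ultimately show ?thesis
    using has_sum_deriv_barnes_zeta[of M a N b "q + b 0"] a b MN
    by (simp add: barnes_S_eq_iterated_diff)
qed

text \<open>The differences of \<open>Ln\<close> at \<open>y\<close> are of order
  \<open>y powr (-N)\<close>. Half a power is split off to give decay in \<open>m\<close> uniformly
  over the lattice, and the rest remains summable.\<close>

lemma barnes_S_tendsto_0:
  assumes a: "\<And>i. i \<in> {1..M} \<Longrightarrow> a i > 0" and b: "\<And>j. j \<in> {0..N} \<Longrightarrow> b j > 0"
    and MN: "M < N"
  shows "(\<lambda>m. barnes_S N b (barnes_L M a) (of_nat m)) \<longlonglongrightarrow> 0"
proof -
  define C where "C = fact (N - 1) * (\<Prod>j\<in>{1..N}. b j)"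
  have C: "C \<ge> 0" unfolding C_def using b by (auto intro!: mult_nonneg_nonneg prod_nonneg simp: less_imp_le)
  have b0: "b 0 > 0" using b by simp
  \<comment> \<open>As \<open>N \<ge> M + 1\<close>, giving up 1/2 keeps the exponent above
    \<open>M\<close>.\<close>
  define \<sigma> where "\<sigma> = real N - 1/2"
  define B where "B = (\<Sum>\<^sub>\<infinity>n\<in>multi_indices M. (b 0 + lattice_sum M a n) powr (-\<sigma>))"
  have \<sigma>: "\<sigma> > real M" using MN by (simp add: \<sigma>_def)
  have B: "((\<lambda>n. (b 0 + lattice_sum M a n) powr (-\<sigma>)) has_sum B) (multi_indices M)"
    unfolding B_def by (intro has_sum_infsum summable_on_lattice_powr a b0 \<sigma>)
  have le: "norm (barnes_S N b (barnes_L M a) (of_nat m)) \<le> C * (real m + b 0) powr (-(1/2)) * B" for m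
  proof (rule norm_infsum_le)
    show "((\<lambda>n. - iterated_diff N b Ln (of_real (real m + b 0 + lattice_sum M a n))) has_sum
           barnes_S N b (barnes_L M a) (of_nat m)) (multi_indices M)"
      using has_sum_barnes_S[of M a N b "real m"] a b MN by simp
    show "((\<lambda>n. C * (real m + b 0) powr (-(1/2)) * (b 0 + lattice_sum M a n) powr (-\<sigma>)) has_sum
        C * (real m + b 0) powr (-(1/2)) * B) (multi_indices M)"
      by (intro has_sum_cmult_right B)
    fix n
    define y where "y = real m + b 0 + lattice_sum M a n"
    have nn: "lattice_sum M a n \<ge> 0" using lattice_sum_nonneg[of M a n] a by simp
    then have y: "y > 0" using b0 by (simp add: y_def)
    have "norm (- iterated_diff N b Ln (of_real y)) \<le> C * y powr (- real N)"
      unfolding C_def norm_minus_cancel using y MN b by (intro norm_iterated_diff_Ln_le) auto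
    also have "y powr (- real N) = y powr (-(1/2)) * y powr (-\<sigma>)"
      by (simp add: \<sigma>_def flip: powr_add)
    \<comment> \<open>The two factors use different lower bounds for \<open>y\<close>:
      \<open>m + b 0\<close>, and \<open>b 0\<close> plus the lattice sum.\<close>
    also have "C * (y powr (-(1/2)) * y powr (-\<sigma>)) \<le>
        C * ((real m + b 0) powr (-(1/2)) * (b 0 + lattice_sum M a n) powr (-\<sigma>))"
      using C b0 nn \<sigma> by (intro mult_left_mono mult_mono powr_mono2') (auto simp: y_def)
    finally show "norm (- iterated_diff N b Ln (of_real (real m + b 0 + lattice_sum M a n))) \<le>
        C * (real m + b 0) powr (-(1/2)) * (b 0 + lattice_sum M a n) powr (-\<sigma>)"
      by (simp add: y_def mult.assoc)
  qed
  have "filterlim (\<lambda>m. real m + b 0) at_top sequentially"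
    using filterlim_tendsto_add_at_top[OF tendsto_const filterlim_real_sequentially, of "b 0"]
    by (simp add: add.commute)
  then have "(\<lambda>m. (real m + b 0) powr (-(1/2))) \<longlonglongrightarrow> 0"
    by (intro tendsto_neg_powr) auto
  then have "(\<lambda>m. C * (real m + b 0) powr (-(1/2)) * B) \<longlonglongrightarrow> 0"
    by (intro tendsto_mult_left_zero tendsto_mult_right_zero)
  then show ?thesis
    by (rule Lim_null_comparison[rotated]) (use le in auto)
qed

text \<open>The exponential turns the alternating sum of logarithms at positive points into the
  bracket of the product formula; the signs become exponents 1 and -1.\<close>

lemma exp_iterated_diff_Ln:
  fixes x :: real
  assumes b: "\<And>j. j \<in> {1..N} \<Longrightarrow> b j > 0" and x: "x > 0"
  shows "exp (iterated_diff N b Ln (of_real x)) =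
    of_real (\<Prod>J\<in>Pow {1..N}. (x + (\<Sum>j\<in>J. b j)) powi ((-1) ^ card J))"
  unfolding iterated_diff_def of_real_prod
proof (subst exp_sum, simp, rule prod.cong)
  fix J assume J: "J \<in> Pow {1..N}"
  define z where "z = x + (\<Sum>j\<in>J. b j)"
  have "(\<Sum>j\<in>J. b j) \<ge> 0" using J b by (intro sum_nonneg) (auto simp: less_imp_le subset_iff)
  then have z: "complex_of_real z \<noteq> 0" using x by (simp add: z_def del: of_real_add)
  have "exp ((-1) ^ card J * Ln (of_real z)) = of_real (z powi ((-1) ^ card J))"
    using z by (cases "even (card J)") (simp_all add: exp_minus power_int_minus)
  then show "exp ((-1) ^ card J * Ln (of_real x + of_real (\<Sum>j\<in>J. b j))) =
      complex_of_real ((x + (\<Sum>j\<in>J. b j)) powi ((-1) ^ card J))"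
    by (simp add: z_def)
qed simp

text \<open>On \<open>(0, 1]\<close> the powers \<open>x ^ m\<close> tend to the indicator of
  \<open>{1}\<close> and are bounded by 1, so dominated convergence applies.\<close>

lemma measure_1_eq_lim_moments:
  assumes "prob_space \<mu>" "sets \<mu> = sets borel" "AE x in \<mu>. x \<in> {0<..1::real}"
    and m: "\<And>m::nat. has_bochner_integral \<mu> (\<lambda>x. complex_of_real x powr of_nat m) (c m)"
  shows "c \<longlonglongrightarrow> of_real (measure \<mu> {1})"
proof -
  interpret prob_space \<mu> by fact
  have meas: "(\<lambda>x. complex_of_real x powr of_nat m) \<in> borel_measurable \<mu>" for m
    using m[of m] by (auto dest: has_bochner_integral_integrable borel_measurable_integrable has_bochner_integral_iff[THEN iffD1])
  have "(\<lambda>m. integral\<^sup>L \<mu> (\<lambda>x. complex_of_real x powr of_nat m)) \<longlonglongrightarrow>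
      integral\<^sup>L \<mu> (\<lambda>x. complex_of_real (indicator {1} x))"
  proof (rule integral_dominated_convergence[where w = "\<lambda>_. 1"])
    have "{1::real} \<in> sets \<mu>" by (simp add: assms(2))
    then show "(\<lambda>x. complex_of_real (indicator {1} x)) \<in> borel_measurable \<mu>" by measurable
    show "AE x in \<mu>. (\<lambda>m. complex_of_real x powr of_nat m) \<longlonglongrightarrow> complex_of_real (indicator {1} x)"
      using assms(3)
    proof eventually_elim
      case (elim x)
      have "(\<lambda>m. x ^ m) \<longlonglongrightarrow> indicator {1} x"
        using elim by (cases "x = 1") (auto intro!: LIMSEQ_realpow_zero)
      then have "(\<lambda>m. complex_of_real (x ^ m)) \<longlonglongrightarrow> complex_of_real (indicator {1} x)"
        by (rule tendsto_of_real)
      then show ?case using elim by (simp add: powr_nat)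
    qed
    show "AE x in \<mu>. norm (complex_of_real x powr of_nat m) \<le> 1" for m
      using assms(3)
    proof eventually_elim
      case (elim x)
      then show ?case by (simp add: powr_nat norm_power power_le_one)
    qed
  qed (use meas in simp_all)
  moreover have "integral\<^sup>L \<mu> (\<lambda>x. complex_of_real (indicator {1} x)) = of_real (measure \<mu> {1})"
    using assms(2) by (simp add: sets_eq_imp_space_eq[OF assms(2)])
  moreover have "integral\<^sup>L \<mu> (\<lambda>x. complex_of_real x powr of_nat m) = c m" for m
    using m by (simp add: has_bochner_integral_iff)
  ultimately show ?thesis by simp
qed

theorem corollary4p9:
  fixes M N :: nat and a b :: "nat \<Rightarrow> real"
    and P :: "'w measure" and \<beta> :: "'w \<Rightarrow> real"
  assumes "M < N"
    and "\<And>i. i \<in> {1..M} \<Longrightarrow> a i > 0"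
    and "\<And>j. j \<in> {0..N} \<Longrightarrow> b j > 0"
    and "prob_space P" and "\<beta> \<in> borel_measurable P"
    and "barnes_beta_law M N a b (distr P borel \<beta>)"
  shows "has_unordered_prod
           (\<lambda>n. \<Prod>J\<in>Pow {1..N}. (b 0 + (\<Sum>j\<in>J. b j) + lattice_sum M a n) powi ((-1) ^ card J))
           (multi_indices M)
           (measure P {\<omega> \<in> space P. \<beta> \<omega> = 1})"
proof -
  let ?S = "barnes_S N b (barnes_L M a)"
  let ?p = "measure P {\<omega> \<in> space P. \<beta> \<omega> = 1}"
  let ?f = "\<lambda>n. \<Prod>J\<in>Pow {1..N}. (b 0 + (\<Sum>j\<in>J. b j) + lattice_sum M a n) powi ((-1) ^ card J)"
  note law = assms(6)[unfolded barnes_beta_law_def]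
  have b0: "b 0 > 0" using assms(3) by simp
  have "(\<lambda>m. barnes_eta M N a b (of_nat m)) \<longlonglongrightarrow> of_real (measure (distr P borel \<beta>) {1})"
    using law b0 by (intro measure_1_eq_lim_moments) auto
  also have "measure (distr P borel \<beta>) {1} = ?p"
    using assms(5) by (subst measure_distr) (auto intro!: arg_cong[where f = "measure P"])
  finally have "(\<lambda>m. barnes_eta M N a b (of_nat m)) \<longlonglongrightarrow> of_real ?p" .
  moreover have "(\<lambda>m. barnes_eta M N a b (of_nat m)) \<longlonglongrightarrow> exp (0 - ?S 0)"
    unfolding barnes_eta_def using assms(1-3)
    by (intro tendsto_exp tendsto_diff tendsto_const barnes_S_tendsto_0) auto
  \<comment> \<open>The moments have two limits, one from the law and one from the formula for
    \<open>barnes_eta\<close>, which must coincide.\<close>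
  ultimately have p: "complex_of_real ?p = exp (- ?S 0)"
    using LIMSEQ_unique by fastforce
  have f: "complex_of_real (?f n) = exp (iterated_diff N b Ln (of_real (b 0 + lattice_sum M a n)))" for n
    using add_pos_nonneg[OF b0 lattice_sum_nonneg[of M a n]] assms(2,3)
    by (subst exp_iterated_diff_Ln) (auto simp: add_ac)
  have "((\<lambda>n. - iterated_diff N b Ln (of_real (b 0 + lattice_sum M a n))) has_sum ?S 0) (multi_indices M)"
    using has_sum_barnes_S[of M a N b 0] assms(1-3) by simp
  then have "((\<lambda>n. iterated_diff N b Ln (of_real (b 0 + lattice_sum M a n))) has_sum - ?S 0) (multi_indices M)"
    by (subst (asm) has_sum_uminus) simp
  \<comment> \<open>Continuity of \<open>exp\<close> turns the unordered sum into an unordered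
    product.\<close>
  then have "((\<lambda>F. exp (\<Sum>n\<in>F. iterated_diff N b Ln (of_real (b 0 + lattice_sum M a n)))) \<longlongrightarrow> exp (- ?S 0))
      (finite_subsets_at_top (multi_indices M))"
    unfolding has_sum_def by (rule tendsto_exp)
  moreover have "eventually (\<lambda>F. exp (\<Sum>n\<in>F. iterated_diff N b Ln (of_real (b 0 + lattice_sum M a n))) =
      complex_of_real (\<Prod>n\<in>F. ?f n)) (finite_subsets_at_top (multi_indices M))"
    by (rule eventually_finite_subsets_at_top_weakI) (simp only: exp_sum of_real_prod[of ?f] f)
  ultimately have "((\<lambda>F. complex_of_real (\<Prod>n\<in>F. ?f n)) \<longlongrightarrow> of_real ?p) (finite_subsets_at_top (multi_indices M))"
    unfolding p by (rule Lim_transform_eventually)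
  then have "((\<lambda>F. \<Prod>n\<in>F. ?f n) \<longlongrightarrow> ?p) (finite_subsets_at_top (multi_indices M))"
    by (simp only: tendsto_of_real_iff)
  \<comment> \<open>By \<open>p\<close> the probability is a value of \<open>exp\<close>, hence
    nonzero as \<open>has_unordered_prod\<close> demands.\<close>
  moreover have "?p \<noteq> 0" using p by auto
  ultimately show ?thesis unfolding has_unordered_prod_def by blast
qed

end
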